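(* Let $G$ be a $4$-cactus with $n$ vertices. Then $|E(G)|\le 2n-2$ if $n\equiv 1 \pmod 3$, and $|E(G)|\le 2n-3$ otherwise. Moreover, these bounds are tight: for every $n\ge 1$ there is a $4$-cactus with $n$ vertices attaining the corresponding bound.
   Context: All graphs are finite and simple. For an integer $k\ge 1$, a $k$-cactus is a connected graph in which every edge is contained in at most $k$ cycles. *)

theory Defs
  imports Main
begin

definition simple_graph :: "'a set \<Rightarrow> 'a set set \<Rightarrow> bool" where
  "simple_graph V E \<longleftrightarrow> finite V \<and> (\<forall>e\<in>E. e \<subseteq> V \<and> card e = 2)"

text \<open>The null graph is not considered connected.\<close>

definition connected_graph :: "'a set \<Rightarrow> 'a set set \<Rightarrow> bool" where
  "connected_graph V E \<longleftrightarrow>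
     V \<noteq> {} \<and> (\<forall>u\<in>V. \<forall>v\<in>V. (u, v) \<in> {(x, y). {x, y} \<in> E}\<^sup>*)"

text \<open>A cycle is a subgraph and is represented by its edge set, which determines it.
  Hence the choice of starting point and orientation of a vertex sequence
  \<open>v\<^sub>0, \<dots>, v\<^sub>m\<^sub>-\<^sub>1\<close> does not affect the number of cycles.\<close>

definition closed_walk_edges :: "'a list \<Rightarrow> 'a set set" where
  "closed_walk_edges vs = {{vs ! i, vs ! (Suc i mod length vs)} | i. i < length vs}"

definition cycles :: "'a set set \<Rightarrow> 'a set set set" where
  "cycles E = {C. C \<subseteq> E \<and>
     (\<exists>vs. distinct vs \<and> 3 \<le> length vs \<and> C = closed_walk_edges vs)}"

definition cactus :: "nat \<Rightarrow> 'a set \<Rightarrow> 'a set set \<Rightarrow> bool" where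
  "cactus k V E \<longleftrightarrow> simple_graph V E \<and> connected_graph V E \<and>
     (\<forall>e\<in>E. card {C \<in> cycles E. e \<in> C} \<le> k)"

end

theory Submission
  imports Defs
begin

text \<open>
  In a connected graph without cut vertex, every edge lies on at least \<open>|E| - |V| + 1\<close> cycles
  (ear decomposition). Hence a \<open>4\<close>-cactus without cut vertex has at most \<open>n + 3\<close> edges, which is
  at most \<open>2n - 3\<close> for \<open>n \<ge> 6\<close>. For \<open>n = 5\<close> it remains to exclude the two graphs with eight edges,
  and for \<open>n \<le> 4\<close> the complete graph suffices as a bound, exceeding \<open>2n - 3\<close> only if \<open>n\<close> is
  \<open>1\<close> or \<open>4\<close>. Splitting at a cut vertex adds up both \<open>|E|\<close> and \<open>n - 1\<close> over the two sides, so by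
  induction \<open>|E| \<le> 2 (n - 1)\<close> in general, and equality forces \<open>n - 1\<close> to be divisible by \<open>3\<close>.
  The bounds are attained by gluing copies of \<open>K\<^sub>4\<close> at vertices to a complete graph on at most three
  vertices.
\<close>

subsection \<open>Paths and cycles\<close>

text \<open>Recursive and without a closing edge, so that paths can be cut, concatenated and
  reversed by list induction.\<close>

fun path_edges :: "'a list \<Rightarrow> 'a set set" where
  "path_edges (x # y # zs) = insert {x, y} (path_edges (y # zs))"
| "path_edges _ = {}"

lemma path_edges_Cons:
  "path_edges (x # zs) = (if zs = [] then {} else insert {x, hd zs} (path_edges zs))"
  by (cases zs) auto

lemma path_edges_append:
  "path_edges (xs @ ys) = path_edges xs \<union> path_edges ys \<union>
     (if xs = [] \<or> ys = [] then {} else {{last xs, hd ys}})"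
  by (induction xs) (auto simp: path_edges_Cons)

lemma path_edges_rev [simp]: "path_edges (rev xs) = path_edges xs"
  by (induction xs) (auto simp: path_edges_Cons path_edges_append last_rev insert_commute)

lemma path_edges_subset_set: "f \<in> path_edges xs \<Longrightarrow> f \<subseteq> set xs"
  by (induction xs rule: path_edges.induct) auto

lemma finite_path_edges [simp]: "finite (path_edges xs)"
  by (induction xs rule: path_edges.induct) auto

lemma card_path_edges: "distinct xs \<Longrightarrow> card (path_edges xs) = length xs - 1"
proof (induction xs rule: path_edges.induct)
  case (1 x y zs)
  then have "{x, y} \<notin> path_edges (y # zs)"
    using path_edges_subset_set[of "{x, y}" "y # zs"] by auto
  with 1 show ?case by simp
qed auto

lemma path_edges_split:
  assumes "f \<in> path_edges xs"
  obtains us p q ws where "xs = us @ p # q # ws" "f = {p, q}"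
proof -
  have "\<exists>us p q ws. xs = us @ p # q # ws \<and> f = {p, q}"
    using assms
  proof (induction xs rule: path_edges.induct)
    case (1 x y zs)
    show ?case
    proof (cases "f = {x, y}")
      case True
      then show ?thesis by (metis append_Nil)
    next
      case False
      with 1 obtain us p q ws where "y # zs = us @ p # q # ws" "f = {p, q}" by auto
      then show ?thesis by (metis append_Cons)
    qed
  qed auto
  then show ?thesis using that by blast
qed

lemma path_edges_conv_nth: "path_edges xs = {{xs ! i, xs ! Suc i} | i. Suc i < length xs}"
proof (induction xs rule: path_edges.induct)
  case (1 x y zs)
  have "{{(x # y # zs) ! i, (x # y # zs) ! Suc i} | i. Suc i < length (x # y # zs)}
      = insert {x, y} {{(y # zs) ! i, (y # zs) ! Suc i} | i. Suc i < length (y # zs)}"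
    (is "?L = ?R")
  proof (rule set_eqI)
    fix f
    have "f \<in> ?L \<longleftrightarrow> (\<exists>i. i < Suc (length zs) \<and> f = {(x # y # zs) ! i, (y # zs) ! i})"
      by auto
    also have "\<dots> \<longleftrightarrow> f = {x, y} \<or> (\<exists>i. i < length zs \<and> f = {(y # zs) ! i, zs ! i})"
      by (auto simp: less_Suc_eq_0_disj)
    also have "\<dots> \<longleftrightarrow> f \<in> ?R" by auto
    finally show "f \<in> ?L \<longleftrightarrow> f \<in> ?R" .
  qed
  with 1 show ?case by simp
qed auto

text \<open>The index \<open>length vs - 1\<close>, where \<open>mod\<close> wraps around,
  contributes the closing edge; all other indices give the edges of the path. Cycles can then be
  handled by list operations instead of indices.\<close>

lemma closed_walk_edges_conv_path_edges:
  assumes "vs \<noteq> []"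
  shows "closed_walk_edges vs = insert {last vs, hd vs} (path_edges vs)"
proof (rule set_eqI)
  fix f
  let ?n = "length vs"
  have n: "?n > 0" using assms by simp
  have "f \<in> closed_walk_edges vs \<longleftrightarrow>
      (\<exists>i. i < ?n \<and> f = {vs ! i, vs ! (Suc i mod ?n)})"
    unfolding closed_walk_edges_def by auto
  also have "\<dots> \<longleftrightarrow> f = {vs ! (?n - 1), vs ! 0} \<or>
      (\<exists>i. Suc i < ?n \<and> f = {vs ! i, vs ! Suc i})" (is "?L \<longleftrightarrow> ?R")
  proof
    assume ?L
    then obtain i where i: "i < ?n" "f = {vs ! i, vs ! (Suc i mod ?n)}" by blast
    show ?R
    proof (cases "Suc i < ?n")
      case True
      then show ?thesis using i by auto
    next
      case False
      then have "i = ?n - 1" "Suc i = ?n" using i by auto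
      then show ?thesis using i by simp
    qed
  next
    assume ?R
    then show ?L
    proof
      assume "f = {vs ! (?n - 1), vs ! 0}"
      then show ?L using n by (intro exI[of _ "?n - 1"]) simp
    next
      assume "\<exists>i. Suc i < ?n \<and> f = {vs ! i, vs ! Suc i}"
      then obtain i where "Suc i < ?n" "f = {vs ! i, vs ! Suc i}" by blast
      then show ?L by (intro exI[of _ i]) simp
    qed
  qed
  also have "\<dots> \<longleftrightarrow> f \<in> insert {last vs, hd vs} (path_edges vs)"
    using assms by (auto simp: path_edges_conv_nth last_conv_nth hd_conv_nth)
  finally show "f \<in> closed_walk_edges vs \<longleftrightarrow> f \<in> insert {last vs, hd vs} (path_edges vs)" .
qed

lemma cycleI:
  assumes "distinct vs" "3 \<le> length vs" "insert {last vs, hd vs} (path_edges vs) \<subseteq> E"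
  shows "insert {last vs, hd vs} (path_edges vs) \<in> cycles E"
proof -
  have "vs \<noteq> []" using assms(2) by auto
  then show ?thesis
    using assms closed_walk_edges_conv_path_edges unfolding cycles_def by blast
qed

text \<open>A vertex list of a cycle may be rotated and reversed without changing the edge set, so
  any chosen edge can be made the closing one. A cycle through \<open>{x, y}\<close> is thus encoded
  by its inner vertices \<open>zs\<close>.\<close>

lemma cycle_through_edgeE:
  assumes "C \<in> cycles E" "{x, y} \<in> C"
  obtains zs where "zs \<noteq> []" "distinct (x # zs @ [y])"
    "C = insert {x, y} (path_edges (x # zs @ [y]))"
proof -
  obtain vs where vs: "distinct vs" "3 \<le> length vs" "C = closed_walk_edges vs"
    using assms(1) unfolding cycles_def by auto
  then have ne: "vs \<noteq> []" by auto
  have C: "C = insert {last vs, hd vs} (path_edges vs)"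
    using vs(3) closed_walk_edges_conv_path_edges[OF ne] by simp
  have "\<exists>ws. distinct ws \<and> 3 \<le> length ws \<and> C = insert {x, y} (path_edges ws) \<and>
          {last ws, hd ws} = {x, y}"
  proof (cases "{x, y} = {last vs, hd vs}")
    case True
    then show ?thesis using vs C by metis
  next
    case False
    then have "{x, y} \<in> path_edges vs" using assms(2) C by simp
    then obtain us p q ws where s: "vs = us @ p # q # ws" "{x, y} = {p, q}"
      by (rule path_edges_split)
    \<comment> \<open>Rotation at the edge \<open>{p, q}\<close>: the former closing edge now joins
      the two blocks, and \<open>{p, q}\<close> closes the list.\<close>
    let ?w = "(q # ws) @ (us @ [p])"
    have "C = insert {p, q} (path_edges ?w)"
      unfolding C s path_edges_append
      by (auto simp: path_edges_Cons hd_append path_edges_append insert_commute)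
    moreover have "distinct ?w" "3 \<le> length ?w" using vs unfolding s by auto
    moreover have "{last ?w, hd ?w} = {x, y}" using s by auto
    ultimately show ?thesis using s(2) by metis
  qed
  then obtain ws where ws: "distinct ws" "3 \<le> length ws" "C = insert {x, y} (path_edges ws)"
    "{last ws, hd ws} = {x, y}" by blast
  have "\<exists>ws. distinct ws \<and> 3 \<le> length ws \<and> C = insert {x, y} (path_edges ws) \<and>
          hd ws = x \<and> last ws = y"
  proof (cases "hd ws = x \<and> last ws = y")
    case True
    then show ?thesis using ws by blast
  next
    case False
    have "hd (rev ws) = x \<and> last (rev ws) = y"
      using False ws(4) by (auto simp: doubleton_eq_iff hd_rev last_rev)
    then show ?thesis using ws by (intro exI[of _ "rev ws"]) simp
  qed
  then obtain ws where ws: "distinct ws" "3 \<le> length ws" "C = insert {x, y} (path_edges ws)"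
    "hd ws = x" "last ws = y" by blast
  obtain w vs where 1: "ws = w # vs" using ws(2) by (cases ws) auto
  then have "vs \<noteq> []" using ws(2) by auto
  then obtain zs z where 2: "vs = zs @ [z]" by (metis append_butlast_last_id)
  have "ws = x # zs @ [y]" "zs \<noteq> []" using ws 1 2 by auto
  then show ?thesis using that ws by metis
qed

lemma finite_cycles: "finite E \<Longrightarrow> finite (cycles E)"
  by (rule finite_subset[of _ "Pow E"]) (auto simp: cycles_def)

lemma cycles_mono: "E \<subseteq> F \<Longrightarrow> cycles E \<subseteq> cycles F"
  unfolding cycles_def by auto

section \<open>Simple graphs, connectivity by crossing edges, paths from reachability\<close>

lemma simple_graph_finite_edges: "simple_graph V E \<Longrightarrow> finite E"
  by (rule finite_subset[of _ "Pow V"]) (auto simp: simple_graph_def)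

lemma simple_graph_edgeE:
  assumes "simple_graph V E" "f \<in> E"
  obtains x y where "f = {x, y}" "x \<noteq> y" "x \<in> V" "y \<in> V"
  using assms unfolding simple_graph_def by (metis card_2_iff insert_subset)

text \<open>Without an edge leaving \<open>S\<close>, no walk can leave \<open>S\<close>;
  conversely, the set of vertices reachable from \<open>u\<close> has no leaving edge and so must be
  \<open>V\<close>. In the forward direction simplicity keeps the vertices of a walk inside
  \<open>V\<close>.\<close>

lemma connected_graph_iff_crossing_edge:
  assumes "simple_graph V E"
  shows "connected_graph V E \<longleftrightarrow> V \<noteq> {} \<and>
    (\<forall>S. S \<noteq> {} \<and> S \<subset> V \<longrightarrow> (\<exists>x\<in>S. \<exists>y\<in>V - S. {x, y} \<in> E))"
proof (intro iffI conjI allI impI)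
  assume c: "connected_graph V E"
  then show "V \<noteq> {}" by (simp add: connected_graph_def)
  fix S assume S: "S \<noteq> {} \<and> S \<subset> V"
  then obtain u v where uv: "u \<in> S" "v \<in> V" "v \<notin> S" by blast
  show "\<exists>x\<in>S. \<exists>y\<in>V - S. {x, y} \<in> E"
  proof (rule ccontr)
    assume n: "\<not> ?thesis"
    have "(u, v) \<in> {(x, y). {x, y} \<in> E}\<^sup>*" using c uv S unfolding connected_graph_def by auto
    then have "v \<in> S"
    proof induction
      case base
      then show ?case using uv by simp
    next
      case (step y z)
      then have "z \<in> V" using assms unfolding simple_graph_def by auto
      then show ?case using n step by auto
    qed
    then show False using uv by simp
  qed
next
  assume c: "V \<noteq> {} \<and> (\<forall>S. S \<noteq> {} \<and> S \<subset> V \<longrightarrow> (\<exists>x\<in>S. \<exists>y\<in>V - S. {x, y} \<in> E))"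
  show "connected_graph V E"
    unfolding connected_graph_def
  proof (intro conjI ballI)
    fix u v assume u: "u \<in> V" and v: "v \<in> V"
    let ?R = "{(x, y). {x, y} \<in> E}"
    define S where "S = {w \<in> V. (u, w) \<in> ?R\<^sup>*}"
    have "S = V"
    proof (rule ccontr)
      assume "S \<noteq> V"
      then have "S \<noteq> {} \<and> S \<subset> V" using u unfolding S_def by auto
      then obtain x y where "x \<in> S" "y \<in> V - S" "{x, y} \<in> E" using c by blast
      then show False unfolding S_def by (auto dest: rtrancl_into_rtrancl)
    qed
    then show "(u, v) \<in> ?R\<^sup>*" using v unfolding S_def by auto
  qed (use c in simp)
qed

text \<open>The relation restricts only the target of a step, hence the separate hypothesis on
  \<open>u\<close>. Distinctness is kept by cutting off the loop whenever the walk returns to a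
  vertex of the path.\<close>

lemma path_from_rtrancl:
  assumes "(u, s) \<in> {(x, y). {x, y} \<in> E \<and> y \<in> U}\<^sup>*" "u \<in> U"
  shows "\<exists>ps. ps \<noteq> [] \<and> distinct ps \<and> set ps \<subseteq> U \<and> hd ps = u \<and> last ps = s \<and> path_edges ps \<subseteq> E"
  using assms(1)
proof induction
  case base
  then show ?case using assms(2) by (intro exI[of _ "[u]"]) auto
next
  case (step y z)
  then obtain ps where ps: "ps \<noteq> []" "distinct ps" "set ps \<subseteq> U" "hd ps = u" "last ps = y"
    "path_edges ps \<subseteq> E" by blast
  show ?case
  proof (cases "z \<in> set ps")
    case True
    then obtain as bs where s: "ps = as @ z # bs" by (meson split_list)
    then have "ps = (as @ [z]) @ bs" by simp
    then have "path_edges (as @ [z]) \<subseteq> E" using ps(6) by (simp only: path_edges_append) auto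
    then show ?thesis using ps s by (intro exI[of _ "as @ [z]"]) (auto simp: hd_append)
  next
    case False
    then show ?thesis using ps step
      by (intro exI[of _ "ps @ [z]"]) (auto simp: path_edges_append)
  qed
qed

subsection \<open>Counting cycles through an edge by ears\<close>

text \<open>Confinement to \<open>W\<close> keeps the path disjoint from the inner vertices of ears
  added later. For \<open>a = b\<close> the predicate is false, since a distinct list with equal
  ends has no edges; hence the condition \<open>u \<noteq> v\<close> wherever it is used.\<close>

definition joined_through :: "'a set set \<Rightarrow> 'a set \<Rightarrow> 'a set \<Rightarrow> 'a \<Rightarrow> 'a \<Rightarrow> bool" where
  "joined_through F e W a b \<longleftrightarrow> (\<exists>ps. ps \<noteq> [] \<and> distinct ps \<and> set ps \<subseteq> W \<and> hd ps = a \<and> last ps = b \<and>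
     path_edges ps \<subseteq> F \<and> e \<in> path_edges ps)"

lemma joined_through_sym: "joined_through F e W a b \<Longrightarrow> joined_through F e W b a"
  unfolding joined_through_def
  by (elim exE, rule_tac x = "rev ps" in exI) (auto simp: hd_rev last_rev)

lemma joined_through_mono:
  "joined_through F e W a b \<Longrightarrow> F \<subseteq> F' \<Longrightarrow> W \<subseteq> W' \<Longrightarrow> joined_through F' e W' a b"
  unfolding joined_through_def by (elim exE, rule_tac x = ps in exI) auto

lemma joined_through_extend:
  assumes "joined_through F e W a b" "xs \<noteq> []" "distinct xs" "set xs \<inter> W = {}"
    "path_edges xs \<subseteq> F" "{last xs, a} \<in> F"
  shows "joined_through F e (W \<union> set xs) (hd xs) b"
proof -
  obtain ps where ps: "ps \<noteq> []" "distinct ps" "set ps \<subseteq> W" "hd ps = a" "last ps = b"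
     "path_edges ps \<subseteq> F" "e \<in> path_edges ps"
    using assms(1) unfolding joined_through_def by blast
  then show ?thesis
    using assms unfolding joined_through_def
    by (intro exI[of _ "xs @ ps"]) (auto simp: path_edges_append)
qed

text \<open>From an ear vertex to an old vertex \<open>q\<close>, leave the ear at an end other than
  \<open>q\<close> and continue through \<open>e\<close> inside \<open>W\<close>. For two ear
  vertices, walk outwards from both in opposite directions along the ear and join its ends
  \<open>a\<close> and \<open>b\<close> through \<open>e\<close>.\<close>

lemma joined_through_add_ear:
  assumes joined: "\<And>u v. u \<in> W \<Longrightarrow> v \<in> W \<Longrightarrow> u \<noteq> v \<Longrightarrow> joined_through F e W u v"
    and a: "a \<in> W" and b: "b \<in> W" and "a \<noteq> b"
    and rs: "distinct rs" "set rs \<inter> W = {}"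
    and F': "F' = F \<union> path_edges (a # rs @ [b])"
    and uv: "u \<in> W \<union> set rs" "v \<in> W \<union> set rs" "u \<noteq> v"
  shows "joined_through F' e (W \<union> set rs) u v"
proof -
  have sub: "F \<subseteq> F'" using F' by auto
  have joined': "joined_through F' e W p q" if "p \<in> W" "q \<in> W" "p \<noteq> q" for p q
    using joined_through_mono[OF joined[OF that] sub] by auto
  have left: "path_edges (rev (r1 @ [p])) \<subseteq> F' \<and> {last (rev (r1 @ [p])), a} \<in> F'"
    if "rs = r1 @ p # r2" for r1 p r2
  proof -
    have "a # rs @ [b] = (a # r1 @ [p]) @ (r2 @ [b])" using that by simp
    then have "path_edges (a # (r1 @ [p])) \<subseteq> F'" unfolding F' by (simp only: path_edges_append) auto
    then show ?thesis by (auto simp: path_edges_Cons path_edges_append last_rev hd_rev insert_commute)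
  qed
  have right: "path_edges (p # r2) \<subseteq> F' \<and> {last (p # r2), b} \<in> F'"
    if "rs = r1 @ p # r2" for r1 p r2
  proof -
    have "a # rs @ [b] = (a # r1) @ ((p # r2) @ [b])" using that by simp
    then have "path_edges ((p # r2) @ [b]) \<subseteq> F'" unfolding F' by (simp only: path_edges_append) auto
    then show ?thesis unfolding path_edges_append by auto
  qed
  have one: "joined_through F' e (W \<union> set rs) p q" if p: "p \<in> set rs" and q: "q \<in> W" for p q
  proof -
    obtain r1 r2 where s: "rs = r1 @ p # r2" using p by (meson split_list)
    show ?thesis
    proof (cases "q = a")
      case False
      then have "joined_through F' e (W \<union> set (rev (r1 @ [p]))) (hd (rev (r1 @ [p]))) q"
        using left[OF s] rs s a q by (intro joined_through_extend[OF joined'[of a q]]) auto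
      from joined_through_mono[OF this, of F' "W \<union> set rs"] show ?thesis using s by auto
    next
      case True
      then have "joined_through F' e (W \<union> set (p # r2)) (hd (p # r2)) q"
        using right[OF s] rs s b \<open>a \<noteq> b\<close> q by (intro joined_through_extend[OF joined'[of b q]]) auto
      from joined_through_mono[OF this, of F' "W \<union> set rs"] show ?thesis using s by auto
    qed
  qed
  have two: "joined_through F' e (W \<union> set rs) p q"
    if s: "rs = r1 @ p # r2" "q \<in> set r2" for r1 r2 p q
  proof -
    obtain r3 r4 where r2: "r2 = r3 @ q # r4" using s(2) by (meson split_list)
    then have s': "rs = (r1 @ p # r3) @ q # r4" using s by simp
    \<comment> \<open>The path from \<open>p\<close> back to \<open>a\<close> and through
      \<open>e\<close> to \<open>b\<close> leaves the part of the ear after \<open>p\<close> free,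
      so it can be extended from \<open>b\<close> backwards to \<open>q\<close>.\<close>
    have "joined_through F' e (W \<union> set (rev (r1 @ [p]))) (hd (rev (r1 @ [p]))) b"
      using left[OF s(1)] rs s a b \<open>a \<noteq> b\<close> by (intro joined_through_extend[OF joined'[of a b]]) auto
    then have "joined_through F' e (W \<union> set (r1 @ [p])) b p"
      by (simp add: joined_through_sym)
    then have "joined_through F' e (W \<union> set (r1 @ [p]) \<union> set (q # r4)) (hd (q # r4)) p"
      using right[OF s'] rs s' by (intro joined_through_extend[of _ _ _ b]) auto
    then have "joined_through F' e (W \<union> set (r1 @ [p]) \<union> set (q # r4)) p q"
      by (simp add: joined_through_sym)
    then show ?thesis by (rule joined_through_mono) (auto simp: s')
  qed
  consider "u \<in> W" "v \<in> W" | "u \<in> set rs" "v \<in> W" | "u \<in> W" "v \<in> set rs"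
    | "u \<in> set rs" "v \<in> set rs" using uv by blast
  then show ?thesis
  proof cases
    case 1
    show ?thesis by (rule joined_through_mono[OF joined'[OF 1 uv(3)]]) auto
  next
    case 2
    then show ?thesis by (rule one)
  next
    case 3
    then show ?thesis using one joined_through_sym by metis
  next
    case 4
    then obtain r1 r2 where s: "rs = r1 @ u # r2" by (meson split_list)
    show ?thesis
    proof (cases "v \<in> set r2")
      case True
      then show ?thesis using two s by blast
    next
      case False
      then have "v \<in> set r1" using s 4 uv(3) by auto
      then obtain r3 r4 where "r1 = r3 @ v # r4" by (meson split_list)
      then have "rs = r3 @ v # (r4 @ u # r2)" using s by simp
      then have "joined_through F' e (W \<union> set rs) v u" by (rule two) simp
      then show ?thesis by (rule joined_through_sym)
    qed
  qed
qed

text \<open>The path through \<open>e\<close> between the ends of the ear is closed by the ear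
  itself. An ear without inner vertices must be a new edge: otherwise the path could be that very
  edge and no cycle would arise.\<close>

lemma cycle_through_ear:
  assumes "joined_through F e W a b" "a \<noteq> b" "distinct rs" "set rs \<inter> W = {}" "rs = [] \<Longrightarrow> {a, b} \<notin> F"
  shows "\<exists>C \<in> cycles (F \<union> path_edges (a # rs @ [b])). e \<in> C \<and> path_edges (a # rs @ [b]) \<subseteq> C"
proof -
  obtain ps where ps: "ps \<noteq> []" "distinct ps" "set ps \<subseteq> W" "hd ps = a" "last ps = b"
     "path_edges ps \<subseteq> F" "e \<in> path_edges ps"
    using assms(1) unfolding joined_through_def by blast
  obtain qs where q: "ps = a # qs" using ps(1,4) by (cases ps) auto
  then have "qs \<noteq> []" using ps(5) assms(2) by auto
  then obtain ms where p: "ps = a # ms @ [b]" using q ps(5)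
    by (metis append_butlast_last_id last_ConsR)
  let ?vs = "ps @ rev rs"
  have len: "3 \<le> length ?vs"
  proof (cases "rs = []")
    case True
    then have "ms \<noteq> []" using ps(6) assms(5) p by auto
    then show ?thesis using p by (cases ms) auto
  next
    case False
    then show ?thesis using p by (cases rs) auto
  qed
  have d: "distinct ?vs" using ps(2,3) assms(3,4) by auto
  let ?C = "insert {last ?vs, hd ?vs} (path_edges ?vs)"
  have C: "?C = path_edges ps \<union> path_edges (a # rs @ [b])"
    using ps by (cases rs)
     (auto simp: path_edges_append path_edges_Cons last_rev hd_rev hd_append insert_commute)
  have "?C \<subseteq> F \<union> path_edges (a # rs @ [b])" unfolding C using ps(6) by blast
  then have "?C \<in> cycles (F \<union> path_edges (a # rs @ [b]))" by (rule cycleI[OF d len])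
  moreover have "e \<in> ?C \<and> path_edges (a # rs @ [b]) \<subseteq> ?C" unfolding C using ps(7) by simp
  ultimately show ?thesis by (rule rev_bexI)
qed

section \<open>Ear decompositions of graphs without cut vertex\<close>

text \<open>Deletion of any vertex leaves a connected or empty graph, phrased by crossing edges so
  that the negation directly yields a separated set \<open>S\<close>.\<close>

definition no_cut_vertex :: "'a set \<Rightarrow> 'a set set \<Rightarrow> bool" where
  "no_cut_vertex V E \<longleftrightarrow> (\<forall>a\<in>V. \<forall>S. S \<noteq> {} \<and> S \<subset> V - {a} \<longrightarrow>
     (\<exists>x\<in>S. \<exists>y\<in>V - {a} - S. {x, y} \<in> E))"

text \<open>If \<open>W\<close> is all of \<open>V\<close>, a missing edge is an ear. Otherwise
  leave \<open>W\<close> along an edge \<open>{a, u}\<close>; the component of \<open>u\<close>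
  outside \<open>W\<close> has a neighbour other than \<open>a\<close>, since \<open>a\<close> is no
  cut vertex, and that neighbour lies in \<open>W\<close>.\<close>

lemma ear_exists:
  assumes g: "simple_graph V E" and c: "connected_graph V E" and nc: "no_cut_vertex V E"
    and W: "W \<subseteq> V" and F: "F \<subset> E" "\<And>f. f \<in> F \<Longrightarrow> f \<subseteq> W"
    and xy: "x \<in> W" "y \<in> W" "x \<noteq> y"
  obtains a b rs where "a \<in> W" "b \<in> W" "a \<noteq> b" "distinct rs" "set rs \<inter> W = {}" "set rs \<subseteq> V"
    "path_edges (a # rs @ [b]) \<subseteq> E" "path_edges (a # rs @ [b]) \<inter> F = {}"
proof (cases "W = V")
  case True
  obtain f where f: "f \<in> E" "f \<notin> F" using F by blast
  obtain a b where "f = {a, b}" "a \<noteq> b" "a \<in> V" "b \<in> V" using simple_graph_edgeE[OF g f(1)] .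
  then show ?thesis using f True by (intro that[of a b "[]"]) auto
next
  case False
  then have "W \<noteq> {} \<and> W \<subset> V" using W xy by auto
  then obtain a u where au: "a \<in> W" "u \<in> V - W" "{a, u} \<in> E"
    using c connected_graph_iff_crossing_edge[OF g] by metis
  let ?R = "{(p, q). {p, q} \<in> E \<and> q \<in> V - W}"
  define S where "S = {s. (u, s) \<in> ?R\<^sup>*}"
  have SV: "S \<subseteq> V - W"
  proof
    fix s assume "s \<in> S"
    then have "(u, s) \<in> ?R\<^sup>*" unfolding S_def by simp
    then show "s \<in> V - W" by induction (use au in auto)
  qed
  \<comment> \<open>A second vertex of \<open>W\<close> makes \<open>S\<close> a proper subset of
    \<open>V - {a}\<close>.\<close>
  obtain w where "w \<in> W" "w \<noteq> a" using xy by metis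
  then have "S \<noteq> {} \<and> S \<subset> V - {a}" using SV au W unfolding S_def by auto
  then obtain s b where sb: "s \<in> S" "b \<in> V - {a} - S" "{s, b} \<in> E"
    using nc au W unfolding no_cut_vertex_def by (meson subsetD)
  have bW: "b \<in> W"
  proof (rule ccontr)
    assume "b \<notin> W"
    then have "(s, b) \<in> ?R" using sb by auto
    then have "b \<in> S" using sb(1) unfolding S_def by (auto intro: rtrancl_into_rtrancl)
    then show False using sb by simp
  qed
  obtain rs where rs: "rs \<noteq> []" "distinct rs" "set rs \<subseteq> V - W" "hd rs = u" "last rs = s" "path_edges rs \<subseteq> E"
    using path_from_rtrancl[of u s E "V - W"] sb(1) au unfolding S_def by blast
  have "path_edges (a # rs @ [b]) \<subseteq> E"
    using rs au sb by (auto simp: path_edges_Cons path_edges_append)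
  moreover have "f \<notin> F" if "f \<in> path_edges (a # rs @ [b])" for f
  proof -
    have "f = {a, u} \<or> f = {s, b} \<or> f \<in> path_edges rs"
      using that rs by (auto simp: path_edges_Cons path_edges_append)
    \<comment> \<open>Every edge of the ear meets \<open>V - W\<close>, whereas the edges of
      \<open>F\<close> lie inside \<open>W\<close>.\<close>
    moreover have "f \<inter> set rs \<noteq> {}" if "f \<in> path_edges rs"
      using path_edges_split[OF that] by (metis disjoint_iff in_set_conv_decomp insertI1)
    ultimately have "f \<inter> (V - W) \<noteq> {}" using rs au SV sb by blast
    then show ?thesis using F(2) by blast
  qed
  ultimately show ?thesis using rs au bW sb by (intro that[of a b rs]) auto
qed

text \<open>Ear decomposition starting from the edge \<open>e\<close>: each ear raises the cyclomatic number by one and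
  closes up to at least one new cycle through \<open>e\<close>, because its ends are joined by a path through
  \<open>e\<close>, a property that attaching an ear preserves.\<close>

lemma ear_decomposition:
  assumes g: "simple_graph V E" and c: "connected_graph V E" and nc: "no_cut_vertex V E"
    and W: "W \<subseteq> V" and F: "F \<subseteq> E" "\<And>f. f \<in> F \<Longrightarrow> f \<subseteq> W"
    and xy: "x \<in> W" "y \<in> W" "x \<noteq> y"
    and joined: "\<And>u v. u \<in> W \<Longrightarrow> v \<in> W \<Longrightarrow> u \<noteq> v \<Longrightarrow> joined_through F e W u v"
    and count: "card F + 1 \<le> card W + card {C \<in> cycles F. e \<in> C}"
  shows "card E + 1 \<le> card V + card {C \<in> cycles E. e \<in> C}"
  using W F xy joined count
proof (induction "card E - card F" arbitrary: W F rule: less_induct)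
  case less
  have finE: "finite E" and finV: "finite V"
    using simple_graph_finite_edges[OF g] g unfolding simple_graph_def by auto
  show ?case
  proof (cases "F = E")
    case True
    have "card W \<le> card V" using card_mono[OF finV less.prems(1)] .
    then show ?thesis using less.prems(8) True by simp
  next
    case False
    then have FE: "F \<subset> E" using less.prems(2) by auto
    obtain a b rs where ear: "a \<in> W" "b \<in> W" "a \<noteq> b" "distinct rs" "set rs \<inter> W = {}" "set rs \<subseteq> V"
        "path_edges (a # rs @ [b]) \<subseteq> E" "path_edges (a # rs @ [b]) \<inter> F = {}"
      using ear_exists[OF g c nc less.prems(1) FE less.prems(3-6)] by metis
    define P where "P = path_edges (a # rs @ [b])"
    have d: "distinct (a # rs @ [b])" using ear by auto
    have cP: "card P = length rs + 1" unfolding P_def card_path_edges[OF d] by simp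
    have finF: "finite F" "finite W" "finite P"
      using less.prems(1,2) finE finV finite_subset unfolding P_def by auto
    have cF: "card (F \<union> P) = card F + length rs + 1"
      using card_Un_disjoint[OF finF(1,3)] ear(8) cP unfolding P_def by auto
    have cW: "card (W \<union> set rs) = card W + length rs"
      using card_Un_disjoint[of W "set rs"] finF ear(4,5) distinct_card by (metis Int_commute finite_set)
    have cE: "card F < card E" using psubset_card_mono[OF finE FE] .
    have "rs = [] \<Longrightarrow> {a, b} \<notin> F" using ear(8) by auto
    then obtain C where C: "C \<in> cycles (F \<union> P)" "e \<in> C" "P \<subseteq> C"
      using cycle_through_ear[OF less.prems(7)[OF ear(1-3)] ear(3-5)] unfolding P_def by blast
    \<comment> \<open>The cycle contains the edges of the ear, none of which is in \<open>F\<close>,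
      so it was not counted before.\<close>
    have "P \<noteq> {}" using cP by auto
    then have "\<not> C \<subseteq> F" using C(3) ear(8) unfolding P_def by blast
    then have "C \<notin> cycles F" unfolding cycles_def by auto
    then have "{C \<in> cycles F. e \<in> C} \<subset> {C \<in> cycles (F \<union> P). e \<in> C}"
      using C cycles_mono[of F "F \<union> P"] by auto
    then have cc: "card {C \<in> cycles F. e \<in> C} < card {C \<in> cycles (F \<union> P). e \<in> C}"
      using finite_cycles[of "F \<union> P"] finF by (intro psubset_card_mono) simp_all
    show ?thesis
    proof (rule less.hyps[of "F \<union> P" "W \<union> set rs"])
      show "card E - card (F \<union> P) < card E - card F" using cF cE by linarith
      show "W \<union> set rs \<subseteq> V" using less.prems(1) ear(6) by auto
      show "F \<union> P \<subseteq> E" using less.prems(2) ear(7) unfolding P_def by auto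
      show "f \<subseteq> W \<union> set rs" if "f \<in> F \<union> P" for f
        using that less.prems(3)[of f] path_edges_subset_set[of f "a # rs @ [b]"] ear(1,2)
        unfolding P_def by auto
      show "x \<in> W \<union> set rs" "y \<in> W \<union> set rs" "x \<noteq> y" using less.prems(4-6) by auto
      show "joined_through (F \<union> P) e (W \<union> set rs) u v"
        if "u \<in> W \<union> set rs" "v \<in> W \<union> set rs" "u \<noteq> v" for u v
        using joined_through_add_ear[of W F e a b rs "F \<union> P"] less.prems(7) ear(1-5) that P_def by blast
      show "card (F \<union> P) + 1 \<le> card (W \<union> set rs) + card {C \<in> cycles (F \<union> P). e \<in> C}"
        using less.prems(8) cF cW cc by linarith
    qed
  qed
qed

text \<open>The decomposition starts with \<open>e\<close> alone on its two ends, where the required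
  count \<open>1 + 1 \<le> 2\<close> holds even without any cycle.\<close>

lemma cyclomatic_le_cycles_through_edge:
  assumes g: "simple_graph V E" and c: "connected_graph V E" and nc: "no_cut_vertex V E"
    and e: "e \<in> E"
  shows "card E + 1 \<le> card V + card {C \<in> cycles E. e \<in> C}"
proof -
  obtain x y where xy: "e = {x, y}" "x \<noteq> y" "x \<in> V" "y \<in> V" using simple_graph_edgeE[OF g e] .
  have "joined_through {e} e {x, y} x y"
    unfolding joined_through_def using xy by (intro exI[of _ "[x, y]"]) auto
  then have "joined_through {e} e {x, y} u v" if "u \<in> {x, y}" "v \<in> {x, y}" "u \<noteq> v" for u v
    using that joined_through_sym by (metis empty_iff insert_iff)
  then show ?thesis
    using xy e by (intro ear_decomposition[OF g c nc, of "{x, y}" "{e}" x y]) auto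
qed

subsection \<open>The upper bound\<close>

definition all_edges :: "'a set \<Rightarrow> 'a set set" where
  "all_edges V = {e. e \<subseteq> V \<and> card e = 2}"

lemma card_all_edges: "finite V \<Longrightarrow> card (all_edges V) = card V choose 2"
  unfolding all_edges_def by (rule n_subsets)

lemma simple_graph_iff_all_edges: "simple_graph V E \<longleftrightarrow> finite V \<and> E \<subseteq> all_edges V"
  unfolding simple_graph_def all_edges_def by auto

lemma doubleton_in_all_edges [simp]: "{x, y} \<in> all_edges V \<longleftrightarrow> x \<noteq> y \<and> x \<in> V \<and> y \<in> V"
  unfolding all_edges_def by (auto simp: card_insert_if)

section \<open>The two graphs with five vertices and eight edges\<close>

text \<open>Explicit edge sets in place of vertex lists let this rule and its two longer analogues
  match the cycles enumerated below by unification.\<close>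

lemma cycle_triangle:
  assumes "distinct [p, q, r]" "{{p, q}, {q, r}, {r, p}} \<subseteq> E"
  shows "{{p, q}, {q, r}, {r, p}} \<in> cycles E"
  using cycleI[of "[p, q, r]" E] assms by (simp add: insert_commute)

lemma cycle_quadrangle:
  assumes "distinct [p, q, r, s]" "{{p, q}, {q, r}, {r, s}, {s, p}} \<subseteq> E"
  shows "{{p, q}, {q, r}, {r, s}, {s, p}} \<in> cycles E"
  using cycleI[of "[p, q, r, s]" E] assms by (simp add: insert_commute)

lemma cycle_pentagon:
  assumes "distinct [p, q, r, s, t]" "{{p, q}, {q, r}, {r, s}, {s, t}, {t, p}} \<subseteq> E"
  shows "{{p, q}, {q, r}, {r, s}, {s, t}, {t, p}} \<in> cycles E"
  using cycleI[of "[p, q, r, s, t]" E] assms by (simp add: insert_commute)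

text \<open>Restricted to sets of sets, so that the simplifier expands equations between edge sets
  but not between edges.\<close>

lemma set_set_eq_iff: "A = B \<longleftrightarrow> A \<subseteq> B \<and> B \<subseteq> A" for A B :: "'a set set"
  by (rule set_eq_subset)

text \<open>In the complete graph on five vertices without two disjoint edges, \<open>v\<close> is
  adjacent to all others. Two triangles, two quadrangles and a pentagon through
  \<open>{v, a}\<close> already exceed four.\<close>

lemma five_cycles_disjoint_nonedges:
  assumes d: "distinct [a, b, c, d, v]"
    and E: "E = all_edges {a, b, c, d, v} - {{a, b}, {c, d}}"
  shows "5 \<le> card {C \<in> cycles E. {v, a} \<in> C}"
proof -
  \<comment> \<open>Written as \<open>set\<close> of a list, so that the cardinality reduces to
    distinctness of the list.\<close>
  let ?X = "set [{{v, a}, {a, c}, {c, v}}, {{v, a}, {a, d}, {d, v}},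
    {{v, a}, {a, c}, {c, b}, {b, v}}, {{v, a}, {a, d}, {d, b}, {b, v}},
    {{v, a}, {a, c}, {c, b}, {b, d}, {d, v}}]"
  have "?X \<subseteq> cycles E"
    using d unfolding list.set insert_subset
    by (intro conjI empty_subsetI cycle_triangle cycle_quadrangle cycle_pentagon)
      (auto simp: E doubleton_eq_iff)
  moreover have "finite (cycles E)"
    by (rule finite_cycles) (simp add: E all_edges_def)
  ultimately have "card ?X \<le> card {C \<in> cycles E. {v, a} \<in> C}"
    by (intro card_mono) auto
  moreover have "card ?X = 5"
    using d by (subst distinct_card) (auto simp: set_set_eq_iff doubleton_eq_iff)
  ultimately show ?thesis by simp
qed

text \<open>The only neighbours of \<open>v\<close> are \<open>a\<close> and \<open>b\<close>. A
  cycle through \<open>{v, a}\<close> corresponds to a path from \<open>a\<close> to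
  \<open>b\<close> avoiding \<open>v\<close>, whose inner vertices are none, \<open>c\<close>,
  \<open>d\<close>, or both in either order.\<close>

lemma five_cycles_adjacent_nonedges:
  assumes d: "distinct [a, b, c, d, v]"
    and E: "E = all_edges {a, b, c, d, v} - {{v, c}, {v, d}}"
  shows "5 \<le> card {C \<in> cycles E. {v, a} \<in> C}"
proof -
  let ?X = "set [{{v, a}, {a, b}, {b, v}},
    {{v, a}, {a, c}, {c, b}, {b, v}}, {{v, a}, {a, d}, {d, b}, {b, v}},
    {{v, a}, {a, c}, {c, d}, {d, b}, {b, v}}, {{v, a}, {a, d}, {d, c}, {c, b}, {b, v}}]"
  have "?X \<subseteq> cycles E"
    using d unfolding list.set insert_subset
    by (intro conjI empty_subsetI cycle_triangle cycle_quadrangle cycle_pentagon)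
      (auto simp: E doubleton_eq_iff)
  moreover have "finite (cycles E)"
    by (rule finite_cycles) (simp add: E all_edges_def)
  ultimately have "card ?X \<le> card {C \<in> cycles E. {v, a} \<in> C}"
    by (intro card_mono) auto
  moreover have "card ?X = 5"
    using d by (subst distinct_card) (auto simp: set_set_eq_iff doubleton_eq_iff)
  ultimately show ?thesis by simp
qed

text \<open>Of the ten possible edges two are missing, and these either are disjoint or share a
  vertex; each case has an edge on five cycles.\<close>

lemma cactus_4_five_vertices_not_eight_edges:
  assumes "cactus 4 V E" "card V = 5"
  shows "card E \<noteq> 8"
proof
  assume m: "card E = 8"
  have g: "finite V" "E \<subseteq> all_edges V" using assms unfolding cactus_def simple_graph_iff_all_edges by auto
  have finA: "finite (all_edges V)" using g(1) by (simp add: all_edges_def)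
  have "card (all_edges V - E) = 2"
    using card_Diff_subset[of E "all_edges V"] g finA finite_subset m
    by (auto simp: card_all_edges assms(2) choose_two)
  then obtain f h where fh: "all_edges V - E = {f, h}" "f \<noteq> h" by (meson card_2_iff)
  then have E: "E = all_edges V - {f, h}" using g(2) by blast
  have f: "f \<subseteq> V" "card f = 2" and h: "h \<subseteq> V" "card h = 2"
    using fh(1) unfolding all_edges_def by blast+
  obtain p q where pq: "f = {p, q}" "p \<noteq> q" using f(2) by (meson card_2_iff)
  obtain r s where rs: "h = {r, s}" "r \<noteq> s" using h(2) by (meson card_2_iff)
  have le: "card {C \<in> cycles E. e \<in> C} \<le> 4" if "e \<in> E" for e
    using assms(1) that unfolding cactus_def by blast
  show False
  proof (cases "f \<inter> h = {}")
    case True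
    then have d: "distinct [p, q, r, s]" using pq rs by auto
    have "card (V - {p, q, r, s}) = 1"
      using card_Diff_subset[of "{p, q, r, s}" V] d pq rs f h assms(2) by auto
    then obtain v where "V - {p, q, r, s} = {v}" by (meson card_1_singletonE)
    then have V: "V = {p, q, r, s, v}" "distinct [p, q, r, s, v]" using d pq rs f h by auto
    have EE: "E = all_edges {p, q, r, s, v} - {{p, q}, {r, s}}" using E V(1) pq rs by simp
    have "{v, p} \<in> E" using V(2) unfolding EE by (auto simp: doubleton_eq_iff)
    then show False using le five_cycles_disjoint_nonedges[OF V(2) EE] by fastforce
  next
    case False
    then obtain v where v: "v \<in> f" "v \<in> h" by blast
    obtain c where c: "f = {v, c}" "c \<noteq> v" using v(1) pq by auto
    obtain d where d: "h = {v, d}" "d \<noteq> v" using v(2) rs by auto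
    have cd: "c \<noteq> d" using c d fh(2) by auto
    have "card (V - {v, c, d}) = 2"
      using card_Diff_subset[of "{v, c, d}" V] c d cd f h assms(2) by auto
    then obtain a b where "V - {v, c, d} = {a, b}" "a \<noteq> b" by (meson card_2_iff)
    then have V: "V = {a, b, c, d, v}" "distinct [a, b, c, d, v]" using c d cd f h by auto
    have EE: "E = all_edges {a, b, c, d, v} - {{v, c}, {v, d}}" using E V(1) c d by simp
    have "{v, a} \<in> E" using V(2) unfolding EE by (auto simp: doubleton_eq_iff)
    then show False using le five_cycles_adjacent_nonedges[OF V(2) EE] by fastforce
  qed
qed

section \<open>Splitting at a cut vertex\<close>

text \<open>A set inside \<open>S\<close> has a leaving edge in the whole graph, and this edge stays
  on the side because \<open>S\<close> has neighbours only in \<open>S\<close> and \<open>a\<close>.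
  A set containing \<open>a\<close> is treated through its complement in \<open>W\<close>.\<close>

lemma connected_side_of_cut_vertex:
  assumes g: "simple_graph V E" and c: "connected_graph V E"
    and S: "a \<in> V" "S \<noteq> {}" "S \<subseteq> V - {a}"
    and no: "\<And>x y. x \<in> S \<Longrightarrow> y \<in> V - {a} - S \<Longrightarrow> {x, y} \<notin> E"
  defines "W \<equiv> insert a S"
  shows "connected_graph W {e \<in> E. e \<subseteq> W}"
proof -
  have gW: "simple_graph W {e \<in> E. e \<subseteq> W}"
    using g S unfolding simple_graph_def W_def by (auto intro: finite_subset)
  have cross: "\<exists>x\<in>T. \<exists>y\<in>W - T. {x, y} \<in> E \<and> {x, y} \<subseteq> W" if T: "T \<noteq> {}" "T \<subseteq> S" for T
  proof -
    have "T \<noteq> {} \<and> T \<subset> V" using T S by auto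
    then obtain x y where xy: "x \<in> T" "y \<in> V - T" "{x, y} \<in> E"
      using c connected_graph_iff_crossing_edge[OF g] by metis
    then have "y \<in> W" using no[of x y] T unfolding W_def by auto
    then show ?thesis using xy T unfolding W_def by blast
  qed
  show ?thesis
    unfolding connected_graph_iff_crossing_edge[OF gW]
  proof (intro conjI allI impI)
    show "W \<noteq> {}" unfolding W_def by simp
    fix T assume T: "T \<noteq> {} \<and> T \<subset> W"
    show "\<exists>x\<in>T. \<exists>y\<in>W - T. {x, y} \<in> {e \<in> E. e \<subseteq> W}"
    proof (cases "a \<in> T")
      case False
      then show ?thesis using cross[of T] T unfolding W_def by auto
    next
      case True
      then have "W - T \<noteq> {}" "W - T \<subseteq> S" using T unfolding W_def by auto
      from cross[OF this] obtain x y where "x \<in> W - T" "y \<in> W - (W - T)" "{x, y} \<in> E" "{x, y} \<subseteq> W"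
        by blast
      then have "y \<in> T" "x \<in> W - T" "{y, x} \<in> {e \<in> E. e \<subseteq> W}" by (auto simp: insert_commute)
      then show ?thesis by blast
    qed
  qed
qed

lemma cactus_subgraph:
  assumes "cactus k V E" "W \<subseteq> V" "F \<subseteq> E" "\<And>f. f \<in> F \<Longrightarrow> f \<subseteq> W" "connected_graph W F"
  shows "cactus k W F"
proof -
  have g: "simple_graph V E" using assms(1) unfolding cactus_def by simp
  have "card {C \<in> cycles F. f \<in> C} \<le> k" if "f \<in> F" for f
  proof -
    have "card {C \<in> cycles F. f \<in> C} \<le> card {C \<in> cycles E. f \<in> C}"
      using finite_cycles[OF simple_graph_finite_edges[OF g]] cycles_mono[OF assms(3)]
      by (intro card_mono) auto
    also have "\<dots> \<le> k" using assms(1,3) that unfolding cactus_def by auto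
    finally show ?thesis .
  qed
  then show ?thesis
    using assms g unfolding cactus_def simple_graph_def by (auto intro: finite_subset)
qed

text \<open>Additive form, free of truncated subtraction. The clause on equality is carried through
  the induction, as equality for the whole graph forces equality on both sides of a cut
  vertex.\<close>

lemma cactus_4_edge_bound:
  assumes "cactus 4 V E"
  shows "card E + 2 \<le> 2 * card V \<and> (card E + 2 = 2 * card V \<longrightarrow> card V mod 3 = 1)"
  using assms
proof (induction "card V" arbitrary: V E rule: less_induct)
  case less
  have g: "simple_graph V E" and c: "connected_graph V E"
    using less.prems unfolding cactus_def by auto
  have finV: "finite V" using g unfolding simple_graph_def by simp
  have finE: "finite E" using simple_graph_finite_edges[OF g] .
  have V0: "card V \<noteq> 0" using c finV unfolding connected_graph_def by auto
  show ?case
  proof (cases "card V \<le> 4")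
    case True
    have "finite (all_edges V)" "E \<subseteq> all_edges V"
      using g finV unfolding simple_graph_iff_all_edges by (auto simp: all_edges_def)
    then have le: "card E \<le> card V choose 2" using card_mono card_all_edges[OF finV] by metis
    \<comment> \<open>The values 0, 1, 3, 6 of \<open>card V choose 2\<close> against 0, 2, 4, 6:
      equality is possible only for one or four vertices.\<close>
    consider "card V = 1" | "card V = 2" | "card V = 3" | "card V = 4"
      using True V0 by linarith
    then show ?thesis by cases (use le in \<open>simp_all add: choose_two\<close>)
  next
    case False
    show ?thesis
    proof (cases "no_cut_vertex V E")
      case True
      obtain u where u: "u \<in> V" using V0 by fastforce
      have "{u} \<noteq> {} \<and> {u} \<subset> V" using u False finV by auto
      then obtain e where e: "e \<in> E" using c connected_graph_iff_crossing_edge[OF g] by metis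
      have "card {C \<in> cycles E. e \<in> C} \<le> 4" using less.prems e unfolding cactus_def by blast
      \<comment> \<open>This gives at most \<open>2 * card V - 3\<close> edges from six vertices on;
        for five vertices it leaves eight, one too many.\<close>
      then have "card E \<le> card V + 3"
        using cyclomatic_le_cycles_through_edge[OF g c True e] by linarith
      moreover have "card E \<noteq> 8" if "card V = 5" using cactus_4_five_vertices_not_eight_edges[OF less.prems that] .
      ultimately show ?thesis using False by (cases "card V = 5") auto
    next
      case nc: False
      then obtain a S where a: "a \<in> V" and S: "S \<noteq> {}" "S \<subset> V - {a}"
        and "\<not> (\<exists>x\<in>S. \<exists>y\<in>V - {a} - S. {x, y} \<in> E)"
        unfolding no_cut_vertex_def by meson
      then have no: "{x, y} \<notin> E" if "x \<in> S" "y \<in> V - {a} - S" for x y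
        using that by meson
      define T where "T = V - {a} - S"
      have T: "T \<noteq> {}" "T \<subseteq> V - {a}" using S unfolding T_def by auto
      have no': "{x, y} \<notin> E" if "x \<in> T" "y \<in> V - {a} - T" for x y
        using no[of y x] that unfolding T_def by (auto simp: insert_commute)
      let ?W1 = "insert a S" and ?W2 = "insert a T"
      let ?E1 = "{e \<in> E. e \<subseteq> ?W1}" and ?E2 = "{e \<in> E. e \<subseteq> ?W2}"
      have "connected_graph ?W1 ?E1" using connected_side_of_cut_vertex[OF g c a S(1) _ no] S(2) by auto
      moreover have "connected_graph ?W2 ?E2" using connected_side_of_cut_vertex[OF g c a T no'] by auto
      ultimately have cac: "cactus 4 ?W1 ?E1" "cactus 4 ?W2 ?E2"
        using S(2) T a by (auto intro!: cactus_subgraph[OF less.prems])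
      have fin: "finite S" "finite T" using S(2) T finV by (auto intro: finite_subset)
      have V: "V = insert a (S \<union> T)" "S \<inter> T = {}" "a \<notin> S" "a \<notin> T"
        using S(2) a unfolding T_def by auto
      have cV: "card V = card S + card T + 1" "card ?W1 = card S + 1" "card ?W2 = card T + 1"
        using V fin card_Un_disjoint[of S T] by auto
      have pos: "card S > 0" "card T > 0" using S(1) T(1) fin by (auto simp: card_gt_0_iff)
      have "E \<subseteq> ?E1 \<union> ?E2"
      proof
        fix f assume f: "f \<in> E"
        obtain x y where xy: "f = {x, y}" "x \<noteq> y" "x \<in> V" "y \<in> V"
          using simple_graph_edgeE[OF g f] .
        then show "f \<in> ?E1 \<union> ?E2" using no[of x y] no[of y x] f V
          by (auto simp: insert_commute)
      qed
      then have EU: "E = ?E1 \<union> ?E2" by auto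
      \<comment> \<open>The two sides share only the vertex \<open>a\<close>, too little to contain
        an edge.\<close>
      have "f \<notin> ?E2" if "f \<in> ?E1" for f
      proof
        assume "f \<in> ?E2"
        then have "f \<subseteq> {a}" using that V(2) by blast
        then have "card f \<le> 1" using card_mono[of "{a}" f] by simp
        then show False using that g unfolding simple_graph_def by force
      qed
      then have "?E1 \<inter> ?E2 = {}" by blast
      then have cE: "card E = card ?E1 + card ?E2"
        using EU finE card_Un_disjoint[of ?E1 ?E2] by simp
      have b1: "card ?E1 + 2 \<le> 2 * card ?W1 \<and> (card ?E1 + 2 = 2 * card ?W1 \<longrightarrow> card ?W1 mod 3 = 1)"
        using pos cV by (intro less.hyps cac) linarith
      have b2: "card ?E2 + 2 \<le> 2 * card ?W2 \<and> (card ?E2 + 2 = 2 * card ?W2 \<longrightarrow> card ?W2 mod 3 = 1)"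
        using pos cV by (intro less.hyps cac) linarith
      show ?thesis
      proof (intro conjI impI)
        show "card E + 2 \<le> 2 * card V" using b1 b2 cV cE by linarith
        assume "card E + 2 = 2 * card V"
        then have "card ?E1 + 2 = 2 * card ?W1" "card ?E2 + 2 = 2 * card ?W2"
          using b1 b2 cV cE by linarith+
        \<comment> \<open>Both \<open>card S\<close> and \<open>card T\<close> are divisible by 3,
          hence so is \<open>card V - 1\<close>.\<close>
        then have "(card S + 1) mod 3 = 1" "(card T + 1) mod 3 = 1" using b1 b2 cV by simp_all
        then show "card V mod 3 = 1" unfolding cV by presburger
      qed
    qed
  qed
qed

subsection \<open>Gluing and the extremal examples\<close>

lemma connected_graph_all_edges: "V \<noteq> {} \<Longrightarrow> connected_graph V (all_edges V)"
  unfolding connected_graph_def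
proof (intro conjI ballI)
  fix u v assume "u \<in> V" "v \<in> V"
  then show "(u, v) \<in> {(x, y). {x, y} \<in> all_edges V}\<^sup>*"
    by (cases "u = v") (auto intro: r_into_rtrancl)
qed

text \<open>Besides the ends of an edge there are at most two vertices \<open>z\<close>,
  \<open>w\<close>. A cycle through the edge is determined by its list of inner vertices, for which
  only \<open>[z]\<close>, \<open>[w]\<close>, \<open>[z, w]\<close> and \<open>[w, z]\<close>
  remain.\<close>

lemma complete_graph_cactus:
  assumes V: "finite V" "V \<noteq> {}" "card V \<le> 4"
  shows "cactus 4 V (all_edges V)"
proof -
  have g: "simple_graph V (all_edges V)" using V(1) by (simp add: simple_graph_iff_all_edges)
  have "card {C \<in> cycles (all_edges V). e \<in> C} \<le> 4" if e: "e \<in> all_edges V" for e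
  proof -
    obtain x y where xy: "e = {x, y}" "x \<noteq> y" "x \<in> V" "y \<in> V" using simple_graph_edgeE[OF g e] .
    have "card (V - {x, y}) \<le> 2" using V xy by (simp add: card_Diff_subset)
    then consider "card (V - {x, y}) = 0" | "card (V - {x, y}) = 1" | "card (V - {x, y}) = 2"
      by linarith
    \<comment> \<open>Only an inclusion is asked for, so fewer than two remaining vertices need no
      separate count.\<close>
    then have "\<exists>z w. V - {x, y} \<subseteq> {z, w}"
    proof cases
      case 1
      then show ?thesis using V(1) by auto
    next
      case 2
      then show ?thesis by (metis card_1_singletonE insertI1 singletonD subsetI)
    next
      case 3
      then obtain z w where "V - {x, y} = {z, w}" by (meson card_2_iff)
      then have "V - {x, y} \<subseteq> {z, w}" by (rule equalityD1)
      then show ?thesis by (intro exI)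
    qed
    then obtain z w where zw: "V - {x, y} \<subseteq> {z, w}" by blast
    let ?X = "(\<lambda>zs. insert {x, y} (path_edges (x # zs @ [y]))) ` set [[z], [w], [z, w], [w, z]]"
    have "{C \<in> cycles (all_edges V). e \<in> C} \<subseteq> ?X"
    proof
      fix C assume C: "C \<in> {C \<in> cycles (all_edges V). e \<in> C}"
      then obtain zs where zs: "zs \<noteq> []" "distinct (x # zs @ [y])"
        "C = insert {x, y} (path_edges (x # zs @ [y]))"
        using cycle_through_edgeE[of C "all_edges V" x y] xy(1) by blast
      have "C \<subseteq> all_edges V" using C unfolding cycles_def by auto
      have "set zs \<subseteq> V"
      proof
        fix p assume "p \<in> set zs"
        then obtain us vs where s: "zs = us @ p # vs" by (meson split_list)
        \<comment> \<open>The edge from the predecessor of \<open>p\<close> lies in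
          \<open>C\<close>, which places \<open>p\<close> in \<open>V\<close>.\<close>
        have "x # zs @ [y] = (x # us) @ (p # vs @ [y])" using s by simp
        then have "{last (x # us), p} \<in> C" using zs(3) by (simp only: path_edges_append) auto
        then show "p \<in> V" using \<open>C \<subseteq> all_edges V\<close> by (metis doubleton_in_all_edges subsetD)
      qed
      then have sub: "set zs \<subseteq> {z, w}" using zw zs(2) by auto
      have "zs \<in> set [[z], [w], [z, w], [w, z]]"
      proof -
        obtain p ps where p: "zs = p # ps" using zs(1) by (cases zs) auto
        show ?thesis
        proof (cases ps)
          case Nil
          then show ?thesis using p sub by auto
        next
          case (Cons q qs)
          have "qs = []"
          proof (cases qs)
            case (Cons r rs)
            then show ?thesis using p \<open>ps = q # qs\<close> sub zs(2) by auto
          qed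
          then show ?thesis using p Cons sub zs(2) by auto
        qed
      qed
      then show "C \<in> ?X" unfolding zs(3) by (rule imageI)
    qed
    then have "card {C \<in> cycles (all_edges V). e \<in> C} \<le> card ?X" by (intro card_mono) auto
    also have "\<dots> \<le> card (set [[z], [w], [z, w], [w, z]])" by (rule card_image_le) simp
    also have "\<dots> \<le> length [[z], [w], [z, w], [w, z]]" by (rule card_length)
    finally show ?thesis by simp
  qed
  then show ?thesis using g connected_graph_all_edges[OF V(2)] unfolding cactus_def by simp
qed

section \<open>Gluing two graphs at a vertex\<close>

text \<open>Changing sides requires passing through the only common vertex \<open>a\<close>.\<close>

lemma path_avoiding_cut_vertex:
  assumes "V1 \<inter> V2 = {a}" "\<And>f. f \<in> E1 \<Longrightarrow> f \<subseteq> V1" "\<And>f. f \<in> E2 \<Longrightarrow> f \<subseteq> V2"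
  shows "ps \<noteq> [] \<Longrightarrow> a \<notin> set ps \<Longrightarrow> path_edges ps \<subseteq> E1 \<union> E2 \<Longrightarrow> hd ps \<in> V2 \<Longrightarrow> last ps \<in> V2"
proof (induction ps rule: path_edges.induct)
  case (1 p q qs)
  have "p \<notin> V1 \<inter> V2" unfolding assms(1) using 1 by auto
  then have "{p, q} \<notin> E1" using 1 assms(2)[of "{p, q}"] by auto
  then have "{p, q} \<in> E2" using 1 by auto
  then have "q \<in> V2" using assms(3) by auto
  then show ?case using 1 by auto
qed auto

lemma path_returning_through_cut_vertex:
  assumes V: "V1 \<inter> V2 = {a}" "\<And>f. f \<in> E1 \<Longrightarrow> f \<subseteq> V1" "\<And>f. f \<in> E2 \<Longrightarrow> f \<subseteq> V2"
  shows "distinct ps \<Longrightarrow> path_edges ps \<subseteq> E1 \<union> E2 \<Longrightarrow> ps \<noteq> [] \<Longrightarrow> hd ps \<in> V1 \<Longrightarrow> last ps \<in> V1 \<Longrightarrow>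
    path_edges ps \<subseteq> E1"
proof (induction ps rule: path_edges.induct)
  case (1 p q qs)
  have "{p, q} \<in> E1"
  proof (rule ccontr)
    \<comment> \<open>An edge leaving the first side starts at \<open>p = a\<close>. The rest of the
      path avoids \<open>a\<close> and stays in \<open>V2\<close>, yet it ends in \<open>V1\<close>,
      so it would have to end at \<open>a\<close> again.\<close>
    assume "{p, q} \<notin> E1"
    then have "{p, q} \<subseteq> V2" using 1 V(3) by auto
    then have pq: "p \<in> V1 \<inter> V2" "q \<in> V2" using 1 by auto
    then have "p = a" using V(1) by simp
    then have "last (q # qs) \<in> V2"
      using 1 pq(2) by (intro path_avoiding_cut_vertex[OF V]) auto
    then have "last (q # qs) \<in> V1 \<inter> V2" using 1 by simp
    then have "last (q # qs) = p" using V(1) \<open>p = a\<close> by simp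
    then show False using 1(2) last_in_set[of "q # qs"] by auto
  qed
  moreover have "path_edges (q # qs) \<subseteq> E1"
    using 1 V(2)[OF calculation] by auto
  ultimately show ?case by simp
qed auto

text \<open>Apart from \<open>{x, y}\<close>, the cycle is a path between two vertices of
  \<open>V1\<close>, and such a path cannot make an excursion to the other side.\<close>

lemma cycle_within_side:
  assumes "V1 \<inter> V2 = {a}" "\<And>f. f \<in> E1 \<Longrightarrow> f \<subseteq> V1" "\<And>f. f \<in> E2 \<Longrightarrow> f \<subseteq> V2"
    and e: "{x, y} \<in> E1" and C: "C \<in> cycles (E1 \<union> E2)" "{x, y} \<in> C"
  shows "C \<in> cycles E1"
proof -
  obtain zs where zs: "zs \<noteq> []" "distinct (x # zs @ [y])"
    "C = insert {x, y} (path_edges (x # zs @ [y]))"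
    using cycle_through_edgeE[OF C] .
  have "C \<subseteq> E1 \<union> E2" using C(1) unfolding cycles_def by auto
  then have "path_edges (x # zs @ [y]) \<subseteq> E1"
    using path_returning_through_cut_vertex[OF assms(1-3) zs(2)] zs(3) assms(2)[OF e] by auto
  then show ?thesis using C(1) e zs(3) unfolding cycles_def by auto
qed

text \<open>Connectivity passes through \<open>a\<close>, and gluing creates no new cycle through
  any edge.\<close>

lemma cactus_glue:
  assumes c1: "cactus k V1 E1" and c2: "cactus k V2 E2" and V: "V1 \<inter> V2 = {a}"
  shows "cactus k (V1 \<union> V2) (E1 \<union> E2)"
proof -
  have g1: "simple_graph V1 E1" and g2: "simple_graph V2 E2"
    and k1: "connected_graph V1 E1" and k2: "connected_graph V2 E2"
    using c1 c2 unfolding cactus_def by auto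
  have s1: "\<And>f. f \<in> E1 \<Longrightarrow> f \<subseteq> V1" and s2: "\<And>f. f \<in> E2 \<Longrightarrow> f \<subseteq> V2"
    using g1 g2 unfolding simple_graph_def by auto
  have g: "simple_graph (V1 \<union> V2) (E1 \<union> E2)" using g1 g2 unfolding simple_graph_def by auto
  let ?R = "\<lambda>E. {(x, y). {x, y} \<in> E}\<^sup>*"
  have mono: "?R E1 \<subseteq> ?R (E1 \<union> E2)" "?R E2 \<subseteq> ?R (E1 \<union> E2)" by (auto intro!: rtrancl_mono)
  have toa: "(u, a) \<in> ?R (E1 \<union> E2) \<and> (a, u) \<in> ?R (E1 \<union> E2)" if "u \<in> V1 \<union> V2" for u
  proof -
    have "a \<in> V1" "a \<in> V2" using V by auto
    then show ?thesis using that k1 k2 mono unfolding connected_graph_def by blast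
  qed
  have k: "connected_graph (V1 \<union> V2) (E1 \<union> E2)"
    unfolding connected_graph_def
  proof (intro conjI ballI)
    show "V1 \<union> V2 \<noteq> {}" using V by auto
    fix u v assume u: "u \<in> V1 \<union> V2" and v: "v \<in> V1 \<union> V2"
    show "(u, v) \<in> ?R (E1 \<union> E2)"
      using rtrancl_trans[OF toa[OF u, THEN conjunct1] toa[OF v, THEN conjunct2]] .
  qed
  have "card {C \<in> cycles (E1 \<union> E2). e \<in> C} \<le> k" if e: "e \<in> E1 \<union> E2" for e
  proof -
    obtain x y where xy: "e = {x, y}" using simple_graph_edgeE[OF g e] by metis
    have fin: "finite (cycles E1)" "finite (cycles E2)"
      using finite_cycles simple_graph_finite_edges g1 g2 by blast+
    show ?thesis
    proof (cases "e \<in> E1")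
      case True
      have "card {C \<in> cycles (E1 \<union> E2). e \<in> C} \<le> card {C \<in> cycles E1. e \<in> C}"
        using cycle_within_side[OF V s1 s2, where x = x and y = y] True xy fin by (intro card_mono) auto
      also have "\<dots> \<le> k" using c1 True unfolding cactus_def by blast
      finally show ?thesis .
    next
      case False
      then have e2: "e \<in> E2" using e by simp
      have V': "V2 \<inter> V1 = {a}" using V by auto
      have "card {C \<in> cycles (E2 \<union> E1). e \<in> C} \<le> card {C \<in> cycles E2. e \<in> C}"
        using cycle_within_side[OF V' s2 s1, where x = x and y = y] e2 xy fin by (intro card_mono) auto
      also have "\<dots> \<le> k" using c2 e2 unfolding cactus_def by blast
      finally show ?thesis by (simp add: Un_commute)
    qed
  qed
  then show ?thesis using g k unfolding cactus_def by blast
qed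

text \<open>Gluing on a complete graph with four vertices adds three vertices and six edges, which
  preserves both the residue of \<open>n\<close> modulo 3 and the difference between
  \<open>2 * n\<close> and the number of edges.\<close>

lemma extremal_cactus_exists:
  assumes "n \<ge> 1"
  shows "\<exists>(V :: nat set) E. cactus 4 V E \<and> card V = n \<and>
    card E + (if n mod 3 = 1 then 2 else 3) = 2 * n"
  using assms
proof (induction n rule: less_induct)
  case (less n)
  show ?case
  proof (cases "n \<le> 3")
    case True
    then have "cactus 4 {..<n} (all_edges {..<n})"
      using less.prems by (intro complete_graph_cactus) (auto simp: lessThan_empty_iff)
    moreover have "card (all_edges {..<n}) + (if n mod 3 = 1 then 2 else 3) = 2 * n"
    proof -
      consider "n = 1" | "n = 2" | "n = 3" using True less.prems by linarith
      then show ?thesis by cases (auto simp: card_all_edges choose_two)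
    qed
    ultimately show ?thesis by (metis card_lessThan)
  next
    case False
    define m where "m = n - 3"
    have nm: "n = m + 3" "m \<ge> 1" using False unfolding m_def by auto
    then obtain V :: "nat set" and E where VE: "cactus 4 V E" "card V = m"
      "card E + (if m mod 3 = 1 then 2 else 3) = 2 * m"
      using less.IH[of m] by auto
    have gV: "simple_graph V E" using VE(1) unfolding cactus_def by simp
    then have finV: "finite V" unfolding simple_graph_def by simp
    obtain a where a: "a \<in> V" using VE(2) nm(2) by fastforce
    \<comment> \<open>All vertices of \<open>V\<close> lie below \<open>M\<close>, so
      \<open>M\<close>, \<open>M + 1\<close> and \<open>M + 2\<close> are new.\<close>
    obtain M where M: "\<And>v. v \<in> V \<Longrightarrow> v < M" using finV by (metis finite_nat_set_iff_bounded)
    define K where "K = {a, M, M + 1, M + 2}"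
    have VK: "V \<inter> K = {a}" using a M unfolding K_def by fastforce
    have "a < M" using M a by blast
    then have cK: "card K = 4" "finite K" unfolding K_def by auto
    have cac: "cactus 4 (V \<union> K) (E \<union> all_edges K)"
      using cactus_glue[OF VE(1) complete_graph_cactus VK] cK unfolding K_def by auto
    have "card (V \<union> K) + card (V \<inter> K) = card V + card K"
      using card_Un_Int[OF finV cK(2)] by simp
    then have cV: "card (V \<union> K) = n" using VK cK VE(2) nm by simp
    have "E \<inter> all_edges K = {}"
    proof (rule ccontr)
      assume "E \<inter> all_edges K \<noteq> {}"
      then obtain f where f: "f \<in> E" "f \<in> all_edges K" by blast
      then have "f \<subseteq> {a}" "card f = 2"
        using gV VK unfolding simple_graph_def all_edges_def by blast+
      then show False using card_mono[of "{a}" f] by simp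
    qed
    then have "card (E \<union> all_edges K) = card E + 6"
      using card_Un_disjoint[of E "all_edges K"] simple_graph_finite_edges[OF gV] cK
      by (simp add: card_all_edges choose_two) (simp add: all_edges_def)
    then have "card (E \<union> all_edges K) + (if n mod 3 = 1 then 2 else 3) = 2 * n"
      using VE(3) nm by auto
    then show ?thesis using cac cV by blast
  qed
qed

theorem theorem4:
  "(\<forall>(V :: 'a set) E n. cactus 4 V E \<and> card V = n \<longrightarrow>
      (if n mod 3 = 1 then int (card E) \<le> 2 * int n - 2
       else int (card E) \<le> 2 * int n - 3)) \<and>
   (\<forall>n\<ge>1. \<exists>(V :: nat set) E. cactus 4 V E \<and> card V = n \<and>
      (if n mod 3 = 1 then int (card E) = 2 * int n - 2
       else int (card E) = 2 * int n - 3))"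
proof (intro conjI allI impI)
  fix V :: "'a set" and E n
  assume "cactus 4 V E \<and> card V = n"
  \<comment> \<open>For other residues the clause on equality excludes
    \<open>card E + 2 = 2 * n\<close>, which lowers the bound by one.\<close>
  then show "if n mod 3 = 1 then int (card E) \<le> 2 * int n - 2 else int (card E) \<le> 2 * int n - 3"
    using cactus_4_edge_bound[of V E] by auto
next
  fix n :: nat
  assume "n \<ge> 1"
  from extremal_cactus_exists[OF this]
  show "\<exists>(V :: nat set) E. cactus 4 V E \<and> card V = n \<and>
      (if n mod 3 = 1 then int (card E) = 2 * int n - 2 else int (card E) = 2 * int n - 3)"
    by (elim exE conjE, intro exI conjI) (auto split: if_splits)
qed

end
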